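(* Let $M>0$ and let $f=h+\overline{g}\in\mathcal{P}^0_{\mathcal{H}}(M)$ be given by $f(z)=z+\sum_{n=2}^{\infty}a_nz^n+\overline{\sum_{n=2}^{\infty}b_nz^n}$. Then for integer $p\ge1$, $N\ge2$ and $t=[(N-1)/2]$, we have $$\begin{aligned}&|f(z)|^p+\sum_{n=N}^{\infty}(|a_n|+|b_n|)r^n+\operatorname{sgn}(t)\sum_{n=2}^{t}(|a_n|+|b_n|)^2\frac{r^N}{1-r}\\&\quad+\frac{1}{1-r}\sum_{n=t+1}^{\infty}n(n-1)(|a_n|+|b_n|)^2r^{2n}\ \le\ d\left(f(0),\partial f(\mathbb{D})\right)\end{aligned}$$ for $|z|=r\le r_{p,t,N}(M)$, where $r_{p,t,N}(M)\in(0,1)$ is the smallest root of the equation $$\begin{aligned}&\bigl(r+2M(r+(1-r)\ln(1-r))\bigr)^p+2M\left(r+(1-r)\ln(1-r)-\sum_{n=2}^{N-1}\frac{r^n}{n(n-1)}\right)\\&\quad+\operatorname{sgn}(t)\sum_{n=2}^{t}\frac{2M}{n(n-1)}\frac{r^N}{1-r}+\frac{4M^2}{1-r}\left(r^2+(1-r^2)\ln(1-r^2)-\sum_{n=2}^{t}\frac{r^{2n}}{n(n-1)}\right)\\&\quad-1-2M(1-\ln 4)=0 .\end{aligned}$$ The radius $r_{p,t,N}(M)$ is the best possible.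
   Context: $\mathbb{D}=\{z\in\mathbb{C}:|z|<1\}$. $\mathcal{H}_0$ is the class of complex-valued harmonic mappings $f=h+\overline{g}$ in $\mathbb{D}$ with $h,g$ analytic in $\mathbb{D}$, $h(0)=0$, $h'(0)=1$, $g(0)=0$, $g'(0)=0$. For $M>0$, $$\mathcal{P}^0_{\mathcal{H}}(M)=\{f=h+\overline{g}\in\mathcal{H}_0:\ \operatorname{Re}(zh''(z))>-M+|zg''(z)|\ \text{for all } z\in\mathbb{D}\}.$$ $N$ is an integer, $[x]$ is the integer part of $x$, $\operatorname{sgn}(0)=0$ and $\operatorname{sgn}(t)=1$ for $t>0$. Empty sums are $0$; a term with $n=1$ in the sum $\sum_{n\ge t+1}n(n-1)(\cdots)$ vanishes because of the factor $n(n-1)$. $d(f(0),\partial f(\mathbb{D}))$ denotes the Euclidean distance between $f(0)$ and the boundary of $f(\mathbb{D})$, given by $d(f(0),\partial f(\mathbb{D}))=\liminf_{|z|\to1}|f(z)-f(0)|$. "Best possible" means that the radius cannot be replaced by a larger one for the whole class.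
   Formalization: In the radius equation the sum over 2≤n≤t has (2M/(n(n-1)))^2 in place of 2M/(n(n-1)); with the first power the radius is not best possible (e.g. M=1/2, p=1, N=5). Existence of the root is claimed only for 2M(ln 4-1)<1; otherwise there is no root in (0,1). *)

theory Defs
  imports "HOL-Complex_Analysis.Complex_Analysis"
begin

text \<open>Mappings on the unit disc are total functions whose values outside
  \<open>ball 0 1\<close> are irrelevant.\<close>

definition H0_decomp ::
  "(complex \<Rightarrow> complex) \<Rightarrow> (complex \<Rightarrow> complex) \<Rightarrow> (complex \<Rightarrow> complex) \<Rightarrow> bool" where
  "H0_decomp f h g \<longleftrightarrow>
     h holomorphic_on ball 0 1 \<and> g holomorphic_on ball 0 1 \<and>
     h 0 = 0 \<and> deriv h 0 = 1 \<and> g 0 = 0 \<and> deriv g 0 = 0 \<and>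
     (\<forall>z\<in>ball 0 1. f z = h z + cnj (g z))"

definition P0H :: "real \<Rightarrow> (complex \<Rightarrow> complex) set" where
  "P0H M = {f. \<exists>h g. H0_decomp f h g \<and>
     (\<forall>z\<in>ball 0 1. Re (z * deriv (deriv h) z) > - M + cmod (z * deriv (deriv g) z))}"

text \<open>The values \<open>a 0\<close>, \<open>a 1\<close>, \<open>b 0\<close>, \<open>b 1\<close> play no role.\<close>

definition harmonic_expansion ::
  "(complex \<Rightarrow> complex) \<Rightarrow> (nat \<Rightarrow> complex) \<Rightarrow> (nat \<Rightarrow> complex) \<Rightarrow> bool" where
  "harmonic_expansion f a b \<longleftrightarrow> (\<forall>z\<in>ball 0 1.
     summable (\<lambda>n. a (n + 2) * z ^ (n + 2)) \<and> summable (\<lambda>n. b (n + 2) * z ^ (n + 2)) \<and>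
     f z = z + (\<Sum>n. a (n + 2) * z ^ (n + 2)) + cnj (\<Sum>n. b (n + 2) * z ^ (n + 2)))"

text \<open>The distance \<open>d(f(0), \<partial>f(D))\<close> is the lower limit of \<open>|f(z) - f(0)|\<close> as \<open>|z|\<close> tends to 1
  from below. For a non-univalent \<open>f\<close> this can be smaller than the distance from \<open>f 0\<close> to
  \<open>frontier (f ` ball 0 1)\<close>.\<close>

definition bdry_dist :: "(complex \<Rightarrow> complex) \<Rightarrow> ereal" where
  "bdry_dist f = Liminf (filtercomap cmod (at_left 1)) (\<lambda>z. ereal (cmod (f z - f 0)))"

text \<open>For \<open>t = 0\<close> the last series starts at \<open>n = 1\<close>, where the factor \<open>n(n - 1)\<close> vanishes.\<close>

definition bohr_sum ::
  "nat \<Rightarrow> nat \<Rightarrow> nat \<Rightarrow> (complex \<Rightarrow> complex) \<Rightarrow> (nat \<Rightarrow> complex) \<Rightarrow> (nat \<Rightarrow> complex) \<Rightarrow> complex \<Rightarrow> real"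
where
  "bohr_sum p t N f a b z =
     (let r = cmod z; c = (\<lambda>n. cmod (a n) + cmod (b n)) in
        cmod (f z) ^ p
      + (\<Sum>n. c (n + N) * r ^ (n + N))
      + sgn (real t) * (\<Sum>n=2..t. (c n)\<^sup>2) * (r ^ N / (1 - r))
      + 1 / (1 - r) *
          (\<Sum>n. real (n + (t + 1)) * (real (n + (t + 1)) - 1)
                * (c (n + (t + 1)))\<^sup>2 * r ^ (2 * (n + (t + 1)))))"

text \<open>This is the value of \<open>bohr_sum\<close> minus \<open>1 + 2M(1 - ln 4)\<close> when \<open>|a n| + |b n|\<close> is replaced by
  its sharp bound \<open>2M/(n(n - 1))\<close> and \<open>|f z|\<close> by the resulting bound. In particular the finite
  sum over \<open>2 \<le> n \<le> t\<close> contains the \<^emph>\<open>square\<close> of \<open>2M/(n(n - 1))\<close>, as the corresponding sum in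
  \<open>bohr_sum\<close> does. With the first power instead, the root would not be the sharp radius for
  \<open>t \<ge> 2\<close>, and for some \<open>M > 1\<close> the inequality itself would fail.\<close>

definition radius_fun :: "nat \<Rightarrow> nat \<Rightarrow> nat \<Rightarrow> real \<Rightarrow> real \<Rightarrow> real" where
  "radius_fun p t N M r =
     (r + 2 * M * (r + (1 - r) * ln (1 - r))) ^ p
   + 2 * M * (r + (1 - r) * ln (1 - r) - (\<Sum>n=2..N-1. r ^ n / (real n * (real n - 1))))
   + sgn (real t) * (\<Sum>n=2..t. (2 * M / (real n * (real n - 1)))\<^sup>2) * (r ^ N / (1 - r))
   + 4 * M\<^sup>2 / (1 - r) *
       (r\<^sup>2 + (1 - r\<^sup>2) * ln (1 - r\<^sup>2) - (\<Sum>n=2..t. r ^ (2 * n) / (real n * (real n - 1))))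
   - 1 - 2 * M * (1 - ln 4)"

definition least_root01 :: "(real \<Rightarrow> real) \<Rightarrow> real \<Rightarrow> bool" where
  "least_root01 \<Phi> R \<longleftrightarrow> 0 < R \<and> R < 1 \<and> \<Phi> R = 0 \<and> (\<forall>r. 0 < r \<and> r < R \<longrightarrow> \<Phi> r \<noteq> 0)"

definition bohr_holds_upto :: "nat \<Rightarrow> nat \<Rightarrow> nat \<Rightarrow> real \<Rightarrow> real \<Rightarrow> bool" where
  "bohr_holds_upto p t N M \<rho> \<longleftrightarrow>
     (\<forall>f a b. f \<in> P0H M \<longrightarrow> harmonic_expansion f a b \<longrightarrow>
        (\<forall>z. cmod z \<le> \<rho> \<longrightarrow> ereal (bohr_sum p t N f a b z) \<le> bdry_dist f))"

end

theory Submission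
  imports Defs
begin

text \<open>For unimodular \<open>\<epsilon>\<close> the function \<open>M + z (h'' + \<epsilon> g'')\<close> has positive real part and value \<open>M\<close>
  at \<open>0\<close>. Caratheodory's coefficient bound, with \<open>\<epsilon>\<close> aligning \<open>a n\<close> and \<open>b n\<close>, gives
  \<open>|a n| + |b n| \<le> 2M/(n(n - 1))\<close>, hence the upper bounds for \<open>|f|\<close> and for the series. Harnack's
  inequality integrated twice gives \<open>|f z| \<ge> r - 2M((1 + r) ln (1 + r) - r)\<close> for \<open>|z| = r\<close>, hence
  \<open>d \<ge> 1 + 2M(1 - ln 4)\<close>. All these bounds are attained by \<open>z + 2M(z + (1 - z) Ln (1 - z))\<close>, the
  upper ones at \<open>z = r\<close> and the lower one at \<open>z = -r\<close>. As \<open>radius_fun\<close> is strictly increasing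
  on \<open>[0, 1)\<close>, its root separates the radii where the inequality holds from those where it fails.\<close>

subsection \<open>Analytic functions with positive real part\<close>

lemma powser_deriv:
  fixes h :: "complex \<Rightarrow> complex"
  assumes "\<And>z. cmod z < 1 \<Longrightarrow> (\<lambda>n. A n * z ^ n) sums h z" and "cmod z < 1"
  shows "(\<lambda>n. diffs A n * z ^ n) sums deriv h z"
proof (rule termdiffs_sums_strong[OF assms(1) _ assms(2)])
  have "h holomorphic_on ball 0 1"
    by (rule power_series_holomorphic[where a = A]) (simp add: assms(1))
  then show "(h has_field_derivative deriv h z) (at z)"
    by (rule holomorphic_derivI) (use assms(2) in auto)
qed

lemma powser_deriv2:
  fixes h :: "complex \<Rightarrow> complex"
  assumes "\<And>z. cmod z < 1 \<Longrightarrow> (\<lambda>n. A n * z ^ n) sums h z" and "cmod z < 1"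
  shows "(\<lambda>n. diffs (diffs A) n * z ^ n) sums deriv (deriv h) z"
  by (rule powser_deriv[OF powser_deriv[OF assms(1)] assms(2)])

text \<open>The Cayley transform \<open>u\<close> sends the right half-plane into the unit disc and
  \<open>M\<close> to 0, so Schwarz's lemma bounds both \<open>u z\<close> and the derivative of
  \<open>u\<close> at 0.\<close>

lemma cayley_Schwarz:
  assumes hol: "p holomorphic_on ball 0 1" and pos: "\<And>z. cmod z < 1 \<Longrightarrow> Re (p z) > 0"
    and p0: "p 0 = of_real M" and z: "cmod z < 1"
  shows "cmod (p z - of_real M) \<le> cmod z * cmod (p z + of_real M)"
    and "cmod (deriv p 0) \<le> 2 * M"
proof -
  have M: "M > 0" using pos[of 0] p0 by simp
  have nz: "p w + of_real M \<noteq> 0" if "cmod w < 1" for w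
    using pos[OF that] M by (auto simp: complex_eq_iff)
  define u where "u = (\<lambda>w. (p w - of_real M) / (p w + of_real M))"
  have hu: "u holomorphic_on ball 0 1"
    unfolding u_def using nz by (intro holomorphic_intros hol) auto
  have u0: "u 0 = 0" by (simp add: u_def p0)
  have u1: "cmod (u w) < 1" if w: "cmod w < 1" for w
  proof -
    \<comment> \<open>As \<open>M\<close> is real, the two squares differ by 4 M Re (p w) >
      0.\<close>
    have "(cmod (p w - of_real M))\<^sup>2 < (cmod (p w + of_real M))\<^sup>2"
      using pos[OF w] M unfolding cmod_power2 by (simp add: power2_eq_square algebra_simps)
    then have "cmod (p w - of_real M) < cmod (p w + of_real M)"
      by (rule power_less_imp_less_base) simp
    then show ?thesis by (simp add: u_def norm_divide nz[OF w])
  qed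
  have "cmod (u z) \<le> cmod z" using Schwarz_Lemma(1)[OF hu u0 u1 z] by simp
  then show "cmod (p z - of_real M) \<le> cmod z * cmod (p z + of_real M)"
    using nz[OF z] by (simp add: u_def norm_divide divide_le_eq)
  have dp: "(p has_field_derivative deriv p 0) (at 0)"
    by (rule holomorphic_derivI[OF hol]) auto
  have "(u has_field_derivative deriv p 0 / of_real (2 * M)) (at 0)"
    unfolding u_def
    by (rule derivative_eq_intros dp refl)+
      (use nz[of 0] M in \<open>auto simp: p0 field_simps power2_eq_square\<close>)
  then have "deriv u 0 = deriv p 0 / of_real (2 * M)" by (rule DERIV_imp_deriv)
  with Schwarz_Lemma(2)[OF hu u0 u1 z] M show "cmod (deriv p 0) \<le> 2 * M"
    by (simp add: norm_divide divide_le_eq)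
qed

text \<open>The Cayley estimate confines \<open>p z\<close> to the closed disc whose real diameter
  runs from M(1 - r)/(1 + r) to M(1 + r)/(1 - r); the bound is its leftmost point.\<close>

lemma Harnack_lower:
  assumes hol: "p holomorphic_on ball 0 1" and pos: "\<And>z. cmod z < 1 \<Longrightarrow> Re (p z) > 0"
    and p0: "p 0 = of_real M" and z: "cmod z < 1"
  shows "M * (1 - cmod z) / (1 + cmod z) \<le> Re (p z)"
proof (rule ccontr)
  define r where "r = cmod z"
  define x where "x = Re (p z)"
  assume "\<not> ?thesis"
  then have lt: "(1 + r) * x < M * (1 - r)"
    using norm_ge_zero[of z] by (simp add: r_def x_def field_simps add_pos_nonneg)
  have r: "0 \<le> r" "r < 1" using z by (auto simp: r_def)
  have M: "M > 0" using pos[of 0] p0 by simp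
  have x: "x > 0" using pos[OF z] by (simp add: x_def)
  \<comment> \<open>A point left of the smaller endpoint is also left of the larger one. Both linear
    factors are then positive, while their product is a quadratic that the Cayley estimate makes
    nonpositive.\<close>
  have "(1 - r) * x < M * (1 + r)"
    using lt r M x by (smt (verit) mult_less_cancel_left mult_mono mult_right_mono)
  then have "0 < (M * (1 - r) - (1 + r) * x) * (M * (1 + r) - (1 - r) * x)"
    using lt by simp
  also have "\<dots> = (1 - r\<^sup>2) * (x\<^sup>2 + M\<^sup>2) - 2 * M * (1 + r\<^sup>2) * x"
    by (simp add: power2_eq_square algebra_simps)
  also have "\<dots> \<le> 0"
  proof -
    have "(cmod (p z - of_real M))\<^sup>2 \<le> (r * cmod (p z + of_real M))\<^sup>2"
      using cayley_Schwarz(1)[OF hol pos p0 z] by (intro power_mono) (auto simp: r_def)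
    then have "(x - M)\<^sup>2 + (Im (p z))\<^sup>2 \<le> r\<^sup>2 * ((x + M)\<^sup>2 + (Im (p z))\<^sup>2)"
      by (simp add: power_mult_distrib cmod_power2 x_def)
    then have "(1 - r\<^sup>2) * (x\<^sup>2 + M\<^sup>2) - 2 * M * (1 + r\<^sup>2) * x \<le> - ((1 - r\<^sup>2) * (Im (p z))\<^sup>2)"
      by (simp add: power2_eq_square algebra_simps)
    also have "\<dots> \<le> 0" using r by (simp add: power2_le_iff_abs_le abs_square_le_1)
    finally show ?thesis .
  qed
  finally show False by simp
qed

text \<open>Orthogonality of the roots of unity: a geometric sum with ratio
  \<open>\<omega> ^ n\<close>, which equals 1 exactly when \<open>k\<close> divides
  \<open>n\<close>.\<close>

lemma sum_powers_root_unity: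
  assumes "k > 0"
  defines "\<omega> \<equiv> exp (2 * of_real pi * \<i> * of_nat 1 / of_nat k)"
  shows "(\<Sum>j<k. (\<omega> ^ j) ^ n) = (if k dvd n then of_nat k else 0)"
proof -
  have \<omega>: "\<omega> ^ n = exp (2 * of_real pi * \<i> * of_nat n / of_nat k)" for n
    by (simp add: \<omega>_def flip: exp_of_nat_mult) (simp add: algebra_simps)
  have eq1: "\<omega> ^ n = 1 \<longleftrightarrow> k dvd n" for n
    unfolding \<omega> by (rule complex_root_unity_eq_1) (use assms in auto)
  have "(\<Sum>j<k. (\<omega> ^ j) ^ n) = (\<Sum>j<k. (\<omega> ^ n) ^ j)"
    by (simp add: mult.commute flip: power_mult)
  also have "\<dots> = (if k dvd n then of_nat k else 0)"
  proof (cases "k dvd n")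
    case False
    have "(\<omega> ^ n) ^ k = 1" using eq1[of "n * k"] by (simp add: power_mult)
    with False show ?thesis by (simp add: geometric_sum eq1)
  qed (use eq1[of n] in simp)
  finally show ?thesis .
qed

text \<open>Averaging \<open>p\<close> over the \<open>k\<close>-th roots of unity keeps the real part positive and leaves a
  power series in \<open>z ^ k\<close>, so that the bound on the first coefficient applies.\<close>

lemma Caratheodory_coeff:
  assumes S: "\<And>z. cmod z < 1 \<Longrightarrow> (\<lambda>n. c n * z ^ n) sums p z"
    and pos: "\<And>z. cmod z < 1 \<Longrightarrow> Re (p z) > 0"
    and c0: "c 0 = of_real M" and k: "k > 0"
  shows "cmod (c k) \<le> 2 * M"
proof -
  define \<omega> where "\<omega> = exp (2 * of_real pi * \<i> * of_nat 1 / of_nat k)"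
  have no: "cmod \<omega> = 1" by (simp add: \<omega>_def)
  define q where "q = (\<lambda>w. \<Sum>n. c (n * k) * w ^ n)"
  have main: "(\<lambda>n. c (n * k) * w ^ n) sums q w \<and> Re (q w) > 0" if w: "cmod w < 1" for w
  proof -
    \<comment> \<open>The \<open>k\<close>-th roots of \<open>w\<close> are the points
      \<open>\<omega> ^ j * z\<close>, and \<open>q w\<close> turns out to be the average of
      \<open>p\<close> over them.\<close>
    obtain z where z: "z ^ k = w" using exists_complex_root[of k w] k by auto
    have "cmod z ^ k < 1" using w z by (metis norm_power)
    then have z1: "cmod z < 1" using k by (meson linorder_not_le one_le_power)
    have zj: "cmod (\<omega> ^ j * z) < 1" for j using z1 no by (simp add: norm_mult norm_power)
    have "(\<lambda>n. \<Sum>j<k. c n * (\<omega> ^ j * z) ^ n) sums (\<Sum>j<k. p (\<omega> ^ j * z))"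
      by (intro sums_sum S zj)
    also have "(\<lambda>n. \<Sum>j<k. c n * (\<omega> ^ j * z) ^ n)
        = (\<lambda>n. of_nat k * (if k dvd n then c n * z ^ n else 0))"
    proof
      fix n
      have "(\<Sum>j<k. c n * (\<omega> ^ j * z) ^ n) = c n * z ^ n * (\<Sum>j<k. (\<omega> ^ j) ^ n)"
        by (simp add: sum_distrib_left power_mult_distrib mult_ac)
      then show "(\<Sum>j<k. c n * (\<omega> ^ j * z) ^ n) = of_nat k * (if k dvd n then c n * z ^ n else 0)"
        unfolding \<omega>_def sum_powers_root_unity[OF k] by simp
    qed
    finally have "(\<lambda>n. of_nat k * (if k dvd n then c n * z ^ n else 0)) sums (\<Sum>j<k. p (\<omega> ^ j * z))" .
    from sums_divide[OF this, of "of_nat k"]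
    have "(\<lambda>n. if k dvd n then c n * z ^ n else 0) sums
        ((\<Sum>j<k. p (\<omega> ^ j * z)) / of_nat k)"
      using k by simp
    \<comment> \<open>Only multiples of \<open>k\<close> survive the averaging; reindexing by them
      gives a power series in \<open>w\<close>.\<close>
    then have "((\<lambda>n. if k dvd n then c n * z ^ n else 0) \<circ> (\<lambda>n. n * k)) sums
        ((\<Sum>j<k. p (\<omega> ^ j * z)) / of_nat k)"
      unfolding o_def
      by (subst sums_mono_reindex) (use k in \<open>auto simp: strict_mono_def elim!: dvdE\<close>)
    then have s: "(\<lambda>n. c (n * k) * w ^ n) sums ((\<Sum>j<k. p (\<omega> ^ j * z)) / of_nat k)"
      by (simp add: o_def z[symmetric] mult.commute flip: power_mult)
    then have "q w = (\<Sum>j<k. p (\<omega> ^ j * z)) / of_nat k" by (simp add: q_def sums_iff)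
    moreover have "Re ((\<Sum>j<k. p (\<omega> ^ j * z)) / of_nat k) > 0"
      using k pos[OF zj] by (auto intro!: sum_pos divide_pos_pos)
    ultimately show ?thesis using s by simp
  qed
  have hol: "q holomorphic_on ball 0 1"
    by (rule power_series_holomorphic[where a = "\<lambda>n. c (n * k)"]) (use main in simp)
  have "(\<lambda>n. diffs (\<lambda>n. c (n * k)) n * 0 ^ n) sums deriv q 0"
    by (rule powser_deriv) (use main in auto)
  then have d: "deriv q 0 = c k" by (simp add: diffs_def)
  have "(\<lambda>n. c (n * k) * 0 ^ n) sums q 0" using main[of 0] by simp
  then have "q 0 = of_real M" by (simp add: c0)
  from cayley_Schwarz(2)[OF hol _ this, of 0] main d show ?thesis by auto
qed

subsection \<open>Coefficients and growth in the class\<close>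

text \<open>The difference \<open>u\<close> is analytic and also the conjugate of an analytic
  function, so its derivative is both complex linear and antilinear. It vanishes, and
  \<open>u\<close> is constant.\<close>

lemma harmonic_decomp_unique:
  assumes hol: "h holomorphic_on ball 0 1" "g holomorphic_on ball 0 1"
      "k holomorphic_on ball 0 1" "l holomorphic_on ball 0 1"
    and eq: "\<And>z. z \<in> ball 0 1 \<Longrightarrow> h z + cnj (g z) = k z + cnj (l z)"
    and 0: "h 0 = k 0" and z: "z \<in> ball 0 1"
  shows "h z = k z" "g z = l z"
proof -
  define u where "u = (\<lambda>z. h z - k z)"
  define v where "v = (\<lambda>z. l z - g z)"
  have hu: "u holomorphic_on ball 0 1" and hv: "v holomorphic_on ball 0 1"
    unfolding u_def v_def by (intro holomorphic_intros hol)+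
  have uv: "u w = cnj (v w)" if "w \<in> ball 0 1" for w
    using eq[OF that] by (simp add: u_def v_def algebra_simps)
  have "(u has_field_derivative 0) (at w)" if w: "w \<in> ball 0 1" for w
  proof -
    have du: "(u has_field_derivative deriv u w) (at w)" and dv: "(v has_field_derivative deriv v w) (at w)"
      using holomorphic_derivI[OF hu _ w] holomorphic_derivI[OF hv _ w] by auto
    have "((\<lambda>x. cnj (v x)) has_derivative (\<lambda>x. cnj (deriv v w * x))) (at w)"
      using dv unfolding has_field_derivative_def by (intro has_derivative_cnj) 
    then have "(u has_derivative (\<lambda>x. cnj (deriv v w * x))) (at w)"
      by (rule has_derivative_transform_within_open[OF _ open_ball w]) (simp add: uv)
    with du have "(\<lambda>x. deriv u w * x) = (\<lambda>x. cnj (deriv v w * x))"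
      unfolding has_field_derivative_def by (rule has_derivative_unique)
    \<comment> \<open>With d and e the derivatives of \<open>u\<close> and \<open>v\<close>, the
      values at 1 and \<open>\<i>\<close> give d = cnj e and d = - cnj e.\<close>
    from fun_cong[OF this, of 1] fun_cong[OF this, of \<i>] have "deriv u w = 0"
      by (auto simp: complex_eq_iff)
    with du show ?thesis by simp
  qed
  then obtain c where c: "\<And>w. w \<in> ball 0 1 \<Longrightarrow> u w = c"
    using has_field_derivative_zero_constant[of "ball 0 1" u] has_field_derivative_at_within
    by (metis convex_ball)
  have "u z = 0" using c[OF z] c[of 0] 0 by (simp add: u_def)
  then show "h z = k z" "g z = l z" using eq[OF z] by (auto simp: u_def)
qed

text \<open>Uniqueness of the decomposition identifies the analytic parts witnessing membership in
  the class with the given power series. The coefficients of \<open>A\<close> and \<open>B\<close>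
  at 0 and 1 are those forced by the normalization.\<close>

lemma P0H_expansion:
  assumes f: "f \<in> P0H M" and e: "harmonic_expansion f a b"
  defines "A \<equiv> (\<lambda>n. if n = 0 then 0 else if n = 1 then 1 else a n)"
    and "B \<equiv> (\<lambda>n. if n < 2 then 0 else b n)"
  shows "\<exists>h g. \<forall>z. cmod z < 1 \<longrightarrow>
    Re (z * deriv (deriv h) z) > - M + cmod (z * deriv (deriv g) z) \<and>
    (\<lambda>n. A n * z ^ n) sums h z \<and> (\<lambda>n. B n * z ^ n) sums g z"
proof -
  from f obtain h g where H: "H0_decomp f h g"
    and P: "\<And>z. z \<in> ball 0 1 \<Longrightarrow> Re (z * deriv (deriv h) z) > - M + cmod (z * deriv (deriv g) z)"
    unfolding P0H_def by blast
  define k where "k = (\<lambda>z. z + (\<Sum>n. a (n + 2) * z ^ (n + 2)))"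
  define l where "l = (\<lambda>z. \<Sum>n. b (n + 2) * z ^ (n + 2))"
  have K: "(\<lambda>n. A n * z ^ n) sums k z" and L: "(\<lambda>n. B n * z ^ n) sums l z" if z: "cmod z < 1" for z
  proof -
    have "(\<lambda>n. a (n + 2) * z ^ (n + 2)) sums (\<Sum>n. a (n + 2) * z ^ (n + 2))"
      "(\<lambda>n. b (n + 2) * z ^ (n + 2)) sums (\<Sum>n. b (n + 2) * z ^ (n + 2))"
      using e z unfolding harmonic_expansion_def by (auto intro: summable_sums)
    then have "(\<lambda>n. A (n + 2) * z ^ (n + 2)) sums (\<Sum>n. a (n + 2) * z ^ (n + 2))"
      "(\<lambda>n. B (n + 2) * z ^ (n + 2)) sums (\<Sum>n. b (n + 2) * z ^ (n + 2))"
      by (simp_all add: A_def B_def)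
    then show "(\<lambda>n. A n * z ^ n) sums k z" "(\<lambda>n. B n * z ^ n) sums l z"
      unfolding sums_iff_shift[where n = 2 and f = "\<lambda>n. A n * z ^ n"]
        sums_iff_shift[where n = 2 and f = "\<lambda>n. B n * z ^ n"]
      by (simp_all add: A_def B_def k_def l_def numeral_2_eq_2 add.commute)
  qed
  have hol: "k holomorphic_on ball 0 1" "l holomorphic_on ball 0 1"
    by (rule power_series_holomorphic[where a = A], use K in simp)
       (rule power_series_holomorphic[where a = B], use L in simp)
  have "h z = k z" "g z = l z" if "cmod z < 1" for z
    using harmonic_decomp_unique[of h g k l z] H hol e that
    by (auto simp: H0_decomp_def harmonic_expansion_def k_def l_def)
  with K L have "(\<lambda>n. A n * z ^ n) sums h z" "(\<lambda>n. B n * z ^ n) sums g z" if "cmod z < 1" for z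
    using that by simp_all
  with P show ?thesis by (intro exI[of _ h] exI[of _ g]) simp
qed

text \<open>A rotation turns \<open>y\<close> into the direction of \<open>x\<close>. The polar form
  is valid at 0 too, so no case distinction is needed.\<close>

lemma complex_align: "\<exists>\<epsilon>. cmod \<epsilon> = 1 \<and> cmod (x + \<epsilon> * y) = cmod x + cmod y"
proof (intro exI conjI)
  show "cmod (cis (Arg x - Arg y)) = 1" by simp
  have "cis (Arg x - Arg y) * y = of_real (cmod y) * cis (Arg x)"
    by (subst (2) rcis_cmod_Arg[symmetric]) (simp add: rcis_def cis_mult)
  then have "x + cis (Arg x - Arg y) * y = of_real (cmod x + cmod y) * cis (Arg x)"
    using rcis_cmod_Arg[of x] by (simp add: rcis_def algebra_simps)
  then show "cmod (x + cis (Arg x - Arg y) * y) = cmod x + cmod y"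
    by (simp only: norm_mult norm_of_real norm_cis) simp
qed

text \<open>Positivity of the real part holds for every unimodular \<open>\<epsilon>\<close>, so
  \<open>\<epsilon>\<close> may be chosen to suit the single index \<open>n\<close>.\<close>

lemma P0H_coeff_bound:
  assumes f: "f \<in> P0H M" and e: "harmonic_expansion f a b" and n: "n \<ge> 2"
  shows "cmod (a n) + cmod (b n) \<le> 2 * M / (real n * (real n - 1))"
proof -
  define A where "A = (\<lambda>n. if n = 0 then 0 else if n = 1 then 1 else a n)"
  define B where "B = (\<lambda>n. if n < 2 then 0 else b n)"
  obtain h g where P: "\<And>z. cmod z < 1 \<Longrightarrow> Re (z * deriv (deriv h) z) > - M + cmod (z * deriv (deriv g) z)"
    and A: "\<And>z. cmod z < 1 \<Longrightarrow> (\<lambda>n. A n * z ^ n) sums h z"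
    and B: "\<And>z. cmod z < 1 \<Longrightarrow> (\<lambda>n. B n * z ^ n) sums g z"
    using P0H_expansion[OF f e] unfolding A_def B_def by blast
  obtain \<epsilon> where \<epsilon>: "cmod \<epsilon> = 1" "cmod (a n + \<epsilon> * b n) = cmod (a n) + cmod (b n)"
    using complex_align by blast
  \<comment> \<open>The factor \<open>z\<close> in \<open>p\<close> shifts the series of the second
    derivatives by one, so index \<open>n - 1\<close> of \<open>c\<close> carries n(n - 1)(a n +
    \<open>\<epsilon>\<close> b n).\<close>
  define c where "c = (\<lambda>n. case n of 0 \<Rightarrow> of_real M | Suc m \<Rightarrow> diffs (diffs A) m + \<epsilon> * diffs (diffs B) m)"
  define p where "p = (\<lambda>z. z * (deriv (deriv h) z + \<epsilon> * deriv (deriv g) z) + of_real M)"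
  obtain m where m: "n = Suc (Suc m)" using n by (metis add_2_eq_Suc le_Suc_ex)
  have "cmod (c (Suc m)) \<le> 2 * M"
  proof (rule Caratheodory_coeff[where p = p])
    fix z assume z: "cmod z < 1"
    from powser_deriv2[OF A z] powser_deriv2[OF B z]
    have "(\<lambda>n. z * (diffs (diffs A) n * z ^ n + \<epsilon> * (diffs (diffs B) n * z ^ n)))
       sums (z * (deriv (deriv h) z + \<epsilon> * deriv (deriv g) z))"
      by (intro sums_mult sums_add)
    also have "(\<lambda>n. z * (diffs (diffs A) n * z ^ n + \<epsilon> * (diffs (diffs B) n * z ^ n)))
       = (\<lambda>n. c (Suc n) * z ^ Suc n)" by (simp add: c_def algebra_simps fun_eq_iff)
    finally show "(\<lambda>n. c n * z ^ n) sums p z"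
      unfolding p_def by (subst (asm) sums_Suc_iff) (simp add: c_def)
    have "Re (z * (\<epsilon> * deriv (deriv g) z)) \<ge> - cmod (z * (\<epsilon> * deriv (deriv g) z))"
      by (metis abs_Re_le_cmod abs_le_iff minus_le_iff)
    also have "cmod (z * (\<epsilon> * deriv (deriv g) z)) = cmod (z * deriv (deriv g) z)"
      by (simp add: norm_mult \<epsilon>)
    finally show "Re (p z) > 0" using P[OF z] by (simp add: p_def ring_distribs)
  qed (simp_all add: c_def)
  moreover have "c (Suc m) = of_nat (n * (n - 1)) * (a n + \<epsilon> * b n)"
    by (simp add: c_def m diffs_def A_def B_def algebra_simps)
  ultimately have "real (n * (n - 1)) * (cmod (a n) + cmod (b n)) \<le> 2 * M"
    by (simp only: norm_mult norm_of_nat \<epsilon>)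
  moreover have "real (n * (n - 1)) = real n * (real n - 1)" using n by (simp add: of_nat_diff)
  ultimately show ?thesis using n by (simp add: field_simps)
qed

text \<open>Twice integrating the Harnack bound along the ray through \<open>w\<close>; the projection onto \<open>w\<close>
  turns \<open>h + cnj g\<close> into the analytic function \<open>h + w\<^sup>2 g\<close>, so univalence is not needed.\<close>

lemma P0H_lower_growth:
  assumes f: "f \<in> P0H M" and w: "cmod w = 1" and r: "0 \<le> r" "r < 1"
  shows "r - 2 * M * ((1 + r) * ln (1 + r) - r) \<le> Re (cnj w * f (of_real r * w))"
proof -
  from f obtain h g where H: "H0_decomp f h g"
    and P: "\<And>z. z \<in> ball 0 1 \<Longrightarrow> Re (z * deriv (deriv h) z) > - M + cmod (z * deriv (deriv g) z)"
    unfolding P0H_def by blast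
  have hol: "h holomorphic_on ball 0 1" "g holomorphic_on ball 0 1"
    and 0: "h 0 = 0" "deriv h 0 = 1" "g 0 = 0" "deriv g 0 = 0"
    and fz: "\<And>z. z \<in> ball 0 1 \<Longrightarrow> f z = h z + cnj (g z)"
    using H by (auto simp: H0_decomp_def)
  have hol1: "deriv h holomorphic_on ball 0 1" "deriv g holomorphic_on ball 0 1"
    and hol2: "deriv (deriv h) holomorphic_on ball 0 1" "deriv (deriv g) holomorphic_on ball 0 1"
    by (intro holomorphic_deriv hol open_ball)+
  have ww: "cnj w * w = 1" using w by (metis complex_norm_square mult.commute of_real_1 power_one)
  define p where "p = (\<lambda>z. z * (deriv (deriv h) z + w\<^sup>2 * deriv (deriv g) z) + of_real M)"
  have hp: "p holomorphic_on ball 0 1" unfolding p_def by (intro holomorphic_intros hol2)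
  have pp: "Re (p z) > 0" if "cmod z < 1" for z
  proof -
    have "Re (z * (w\<^sup>2 * deriv (deriv g) z)) \<ge> - cmod (z * (w\<^sup>2 * deriv (deriv g) z))"
      by (metis abs_Re_le_cmod abs_le_iff minus_le_iff)
    also have "cmod (z * (w\<^sup>2 * deriv (deriv g) z)) = cmod (z * deriv (deriv g) z)"
      by (simp add: norm_mult norm_power w)
    finally show ?thesis using P[of z] that by (simp add: p_def ring_distribs)
  qed
  \<comment> \<open>\<open>cnj w * cnj (g z)\<close> and \<open>w * g z\<close> have the same real
    part. Each differentiation in \<open>s\<close> brings out a factor \<open>w\<close>; since
    \<open>cnj w * w = 1\<close>, the weights become 1 and w^2, then w and w^3.\<close>
  define \<phi> where "\<phi> = (\<lambda>s. Re (cnj w * h (of_real s * w) + w * g (of_real s * w)))"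
  define \<phi>1 where "\<phi>1 = (\<lambda>s. Re (deriv h (of_real s * w) + w\<^sup>2 * deriv g (of_real s * w)))"
  define \<phi>2 where "\<phi>2 = (\<lambda>s. Re (w * deriv (deriv h) (of_real s * w) + w ^ 3 * deriv (deriv g) (of_real s * w)))"
  have chain: "((\<lambda>s. Re (\<alpha> * F (of_real s * w))) has_real_derivative Re (\<alpha> * w * deriv F (of_real s * w))) (at s)"
    if F: "F holomorphic_on ball 0 1" and s: "\<bar>s\<bar> < 1" for F \<alpha> s
  proof -
    have "(F has_field_derivative deriv F (of_real s * w)) (at (of_real s * w))"
      by (rule holomorphic_derivI[OF F]) (use s w in \<open>auto simp: norm_mult\<close>)
    moreover have "((\<lambda>s. of_real s * w) has_vector_derivative w) (at s)"
      by (auto intro!: derivative_eq_intros)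
    ultimately have "((F \<circ> (\<lambda>s. of_real s * w)) has_vector_derivative w * deriv F (of_real s * w)) (at s)"
      by (intro field_vector_diff_chain_at)
    then have "((\<lambda>s. \<alpha> * F (of_real s * w)) has_vector_derivative \<alpha> * (w * deriv F (of_real s * w))) (at s)"
      unfolding o_def by (rule has_vector_derivative_mult_right)
    then show ?thesis
      by (simp add: has_real_derivative_iff_has_vector_derivative has_vector_derivative_complex_iff mult.assoc)
  qed
  have d\<phi>: "(\<phi> has_real_derivative \<phi>1 s) (at s)" if "\<bar>s\<bar> < 1" for s
    using DERIV_add[OF chain[OF hol(1) that, of "cnj w"] chain[OF hol(2) that, of w]]
    by (simp add: \<phi>_def \<phi>1_def ww power2_eq_square del: times_complex.sel)
  have d\<phi>1: "(\<phi>1 has_real_derivative \<phi>2 s) (at s)" if "\<bar>s\<bar> < 1" for s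
    using DERIV_add[OF chain[OF hol1(1) that, of 1] chain[OF hol1(2) that, of "w\<^sup>2"]]
    by (simp add: \<phi>1_def \<phi>2_def power2_eq_square power3_eq_cube del: times_complex.sel)
  have \<phi>2: "- 2 * M / (1 + s) \<le> \<phi>2 s" if s: "0 < s" "s < 1" for s
  proof -
    have n: "cmod (of_real s * w) = s" using s w by (simp add: norm_mult)
    have "M * (1 - s) / (1 + s) \<le> Re (p (of_real s * w))"
      using Harnack_lower[OF hp pp _ , of M "of_real s * w"] s by (simp add: n p_def)
    moreover have "p (of_real s * w) = of_real s * (w * deriv (deriv h) (of_real s * w)
        + w ^ 3 * deriv (deriv g) (of_real s * w)) + of_real M"
      by (simp add: p_def algebra_simps power2_eq_square power3_eq_cube)
    ultimately have "M * (1 - s) / (1 + s) \<le> s * \<phi>2 s + M"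
      by (simp add: \<phi>2_def)
    \<comment> \<open>The Harnack bound controls \<open>s * \<phi>2 s\<close>, so dividing by
      \<open>s\<close> restricts the estimate to positive \<open>s\<close>.\<close>
    moreover have "M * (1 - s) / (1 + s) - M = s * (- 2 * M / (1 + s))"
      using s by (simp add: field_simps)
    ultimately have "s * (- 2 * M / (1 + s)) \<le> s * \<phi>2 s" by linarith
    then show ?thesis using s by (simp only: mult_le_cancel_left_pos)
  qed
  have \<phi>1: "1 - 2 * M * ln (1 + s) \<le> \<phi>1 s" if s: "0 \<le> s" "s < 1" for s
  proof -
    have "\<phi>1 0 + 2 * M * ln (1 + 0) \<le> \<phi>1 s + 2 * M * ln (1 + s)"
    proof (rule DERIV_nonneg_imp_increasing_open[OF s(1)])
      fix x assume x: "0 < x" "x < s"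
      then have "((\<lambda>x. \<phi>1 x + 2 * M * ln (1 + x)) has_real_derivative \<phi>2 x + 2 * M / (1 + x)) (at x)"
        using s by (auto intro!: derivative_eq_intros d\<phi>1)
      then show "\<exists>y. ((\<lambda>x. \<phi>1 x + 2 * M * ln (1 + x)) has_real_derivative y) (at x) \<and> 0 \<le> y"
        using \<phi>2[of x] x s by fastforce
    next
      have "continuous_on {0..s} \<phi>1"
        by (rule DERIV_continuous_on[where D = \<phi>2])
          (use s in \<open>auto intro!: has_field_derivative_at_within d\<phi>1\<close>)
      then show "continuous_on {0..s} (\<lambda>x. \<phi>1 x + 2 * M * ln (1 + x))"
        by (intro continuous_intros) auto
    qed
    then show ?thesis by (simp add: \<phi>1_def 0)
  qed
  \<comment> \<open>The subtracted function is the antiderivative of 1 - 2M ln (1 + x) that vanishes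
    at 0.\<close>
  have "\<phi> 0 - (0 - 2 * M * ((1 + 0) * ln (1 + 0) - 0)) \<le> \<phi> r - (r - 2 * M * ((1 + r) * ln (1 + r) - r))"
  proof (rule DERIV_nonneg_imp_nondecreasing[OF r(1)])
    fix x assume x: "0 \<le> x" "x \<le> r"
    then have "((\<lambda>x. \<phi> x - (x - 2 * M * ((1 + x) * ln (1 + x) - x))) has_real_derivative
       \<phi>1 x - (1 - 2 * M * ln (1 + x))) (at x)"
      using r by (auto intro!: derivative_eq_intros d\<phi>)
    then show "\<exists>y. ((\<lambda>x. \<phi> x - (x - 2 * M * ((1 + x) * ln (1 + x) - x))) has_real_derivative y) (at x) \<and> 0 \<le> y"
      using \<phi>1[of x] x r by fastforce
  qed
  then have "r - 2 * M * ((1 + r) * ln (1 + r) - r) \<le> \<phi> r"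
    by (simp add: \<phi>_def 0)
  also have "\<phi> r = Re (cnj w * f (of_real r * w))"
    using fz[of "of_real r * w"] r w by (simp add: \<phi>_def norm_mult algebra_simps)
  finally show ?thesis .
qed

text \<open>Projecting \<open>f z\<close> onto the direction of \<open>z\<close> does not increase
  its modulus, so the lower growth bound applies; its limit as r tends to 1 is the constant, as 2 ln
  2 = ln 4.\<close>

lemma bdry_dist_ge:
  assumes "f \<in> P0H M"
  shows "ereal (1 + 2 * M * (1 - ln 4)) \<le> bdry_dist f"
  unfolding bdry_dist_def le_Liminf_iff
proof (intro allI impI)
  fix y assume y: "y < ereal (1 + 2 * M * (1 - ln 4))"
  define \<psi> where "\<psi> = (\<lambda>r::real. r - 2 * M * ((1 + r) * ln (1 + r) - r))"
  have "\<psi> 1 = 1 + 2 * M * (1 - ln 4)"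
    using ln_realpow[of 2 2] by (simp add: \<psi>_def algebra_simps)
  moreover have "(\<psi> \<longlongrightarrow> \<psi> 1) (at_left 1)"
    unfolding \<psi>_def by (intro tendsto_intros) auto
  ultimately have "((\<lambda>r. ereal (\<psi> r)) \<longlongrightarrow> ereal (1 + 2 * M * (1 - ln 4))) (at_left 1)" by simp
  from order_tendstoD(1)[OF this y] have "\<forall>\<^sub>F r in at_left 1. y < ereal (\<psi> r) \<and> 0 < r \<and> r < 1"
    using eventually_at_left_real[of 0 "1::real"] by (auto elim: eventually_elim2)
  moreover have "y < ereal (cmod (f z - f 0))" if "y < ereal (\<psi> (cmod z)) \<and> 0 < cmod z \<and> cmod z < 1" for z
  proof -
    have "f 0 = 0" using assms by (auto simp: P0H_def H0_decomp_def)
    define w where "w = z / of_real (cmod z)"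
    have w: "cmod w = 1" "of_real (cmod z) * w = z" using that by (auto simp: w_def norm_divide)
    have "\<psi> (cmod z) \<le> Re (cnj w * f z)"
      using P0H_lower_growth[OF assms w(1), of "cmod z"] that by (simp add: \<psi>_def w)
    also have "\<dots> \<le> cmod (cnj w * f z)" by (rule complex_Re_le_cmod)
    also have "\<dots> = cmod (f z - f 0)" using \<open>f 0 = 0\<close> w by (simp add: norm_mult)
    finally have "ereal (\<psi> (cmod z)) \<le> ereal (cmod (f z - f 0))" by simp
    with that show ?thesis by (meson less_le_trans)
  qed
  ultimately show "\<forall>\<^sub>F z in filtercomap cmod (at_left 1). y < ereal (cmod (f z - f 0))"
    unfolding eventually_filtercomap by blast
qed

subsection \<open>The series of z + (1 - z) ln (1 - z)\<close>

text \<open>Partial fractions 1/(n(n - 1)) = 1/(n - 1) - 1/n reduce this to two shifted logarithm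
  series. Division by zero yields 0, so the terms at 0 and 1 vanish.\<close>

lemma one_minus_Ln_sums:
  fixes z :: complex
  assumes z: "cmod z < 1"
  shows "(\<lambda>n. z ^ n / (of_nat n * (of_nat n - 1))) sums (z + (1 - z) * Ln (1 - z))"
proof -
  have A: "(\<lambda>n. z ^ n / of_nat n) sums (- Ln (1 - z))"
    using sums_minus[OF Ln_series'[of "- z"]] z by simp
  have A1: "(\<lambda>n. z ^ (n + 1) / of_nat (n + 1)) sums (- Ln (1 - z))"
    using sums_iff_shift[where f = "\<lambda>n. z ^ n / of_nat n" and n = 1] A by simp
  have A2: "(\<lambda>n. z ^ (n + 2) / of_nat (n + 2)) sums (- Ln (1 - z) - z)"
    using sums_iff_shift[where f = "\<lambda>n. z ^ n / of_nat n" and n = 2 and s = "- Ln (1 - z) - z"] A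
    by (simp add: numeral_2_eq_2)
  have "(\<lambda>n. z * (z ^ (n + 1) / of_nat (n + 1)) - z ^ (n + 2) / of_nat (n + 2))
      sums (z * (- Ln (1 - z)) - (- Ln (1 - z) - z))"
    by (intro sums_diff sums_mult A1 A2)
  also have "(\<lambda>n. z * (z ^ (n + 1) / of_nat (n + 1)) - z ^ (n + 2) / of_nat (n + 2))
     = (\<lambda>n. z ^ (n + 2) / (of_nat (n + 2) * (of_nat (n + 2) - 1)))"
  proof
    fix n
    have "of_nat (n + 1) \<noteq> (0::complex)" "of_nat (n + 2) \<noteq> (0::complex)"
      by (simp_all only: of_nat_eq_0_iff)
    moreover have "of_nat (n + 2) - 1 = (of_nat (n + 1) :: complex)" by simp
    ultimately show "z * (z ^ (n + 1) / of_nat (n + 1)) - z ^ (n + 2) / of_nat (n + 2)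
        = z ^ (n + 2) / (of_nat (n + 2) * (of_nat (n + 2) - 1))"
      by (simp add: divide_simps) (simp add: algebra_simps)
  qed
  finally show ?thesis
    using sums_iff_shift[where f = "\<lambda>n. z ^ n / (of_nat n * (of_nat n - 1))" and n = 2
        and s = "z + (1 - z) * Ln (1 - z)"]
    by (simp add: numeral_2_eq_2 algebra_simps)
qed

lemma one_minus_ln_sums:
  fixes x :: real
  assumes x: "\<bar>x\<bar> < 1"
  shows "(\<lambda>n. x ^ n / (real n * (real n - 1))) sums (x + (1 - x) * ln (1 - x))"
proof -
  have "Ln (1 - of_real x) = of_real (ln (1 - x))"
    using Ln_of_real[of "1 - x"] x by simp
  then have "(\<lambda>n. of_real (x ^ n / (real n * (real n - 1)))) sums
      complex_of_real (x + (1 - x) * ln (1 - x))"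
    using one_minus_Ln_sums[of "of_real x"] x by simp
  then show ?thesis by (simp only: sums_of_real_iff)
qed

lemma one_minus_ln_tail_sums:
  fixes x :: real
  assumes x: "\<bar>x\<bar> < 1" and k: "k \<ge> 1"
  shows "(\<lambda>n. x ^ (n + k) / (real (n + k) * (real (n + k) - 1))) sums
    (x + (1 - x) * ln (1 - x) - (\<Sum>n=2..k-1. x ^ n / (real n * (real n - 1))))"
proof -
  have "(\<Sum>n<k. x ^ n / (real n * (real n - 1))) = (\<Sum>n=2..k-1. x ^ n / (real n * (real n - 1)))"
  proof (rule sum.mono_neutral_right)
    have "n = 0 \<or> n = 1" if "n \<in> {..<k} - {2..k - 1}" for n using that by auto
    then show "\<forall>n\<in>{..<k} - {2..k - 1}. x ^ n / (real n * (real n - 1)) = 0"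
      by (metis diff_self div_by_0 mult_zero_left mult_zero_right of_nat_0 of_nat_1)
  qed (use k in auto)
  with sums_split_initial_segment[OF one_minus_ln_sums[OF x], of k] show ?thesis by simp
qed

text \<open>Both claims hold termwise for the tail series, whose coefficients are nonnegative. The
  choice \<open>k = 1\<close> covers the whole function.\<close>

lemma one_minus_ln_tail_mono:
  fixes x y :: real
  assumes "0 \<le> x" "x \<le> y" "y < 1" and k: "k \<ge> 1"
  shows "0 \<le> x + (1 - x) * ln (1 - x) - (\<Sum>n=2..k-1. x ^ n / (real n * (real n - 1)))" (is "0 \<le> ?T x")
    and "x + (1 - x) * ln (1 - x) - (\<Sum>n=2..k-1. x ^ n / (real n * (real n - 1)))
       \<le> y + (1 - y) * ln (1 - y) - (\<Sum>n=2..k-1. y ^ n / (real n * (real n - 1)))"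
proof -
  have nn: "0 \<le> real (n + k) * (real (n + k) - 1)" for n using k by simp
  have S: "(\<lambda>n. x ^ (n + k) / (real (n + k) * (real (n + k) - 1))) sums ?T x"
    "(\<lambda>n. y ^ (n + k) / (real (n + k) * (real (n + k) - 1))) sums ?T y"
    using one_minus_ln_tail_sums[OF _ k] assms by auto
  show "0 \<le> ?T x" by (rule sums_le[OF _ sums_zero S(1)]) (use nn assms in auto)
  show "?T x \<le> ?T y"
    by (rule sums_le[OF _ S]) (intro divide_right_mono power_mono nn assms)
qed

subsection \<open>The radius function\<close>

lemma radius_fun_0:
  assumes "p \<ge> 1" "N \<ge> 2"
  shows "radius_fun p t N M 0 = - (1 + 2 * M * (1 - ln 4))"
proof -
  have "(\<Sum>n=2..k. 0 ^ n / (real n * (real n - 1))) = 0"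
    "(\<Sum>n=2..k. 0 ^ (2 * n) / (real n * (real n - 1))) = 0" for k
    by (intro sum.neutral; simp)+
  then show ?thesis using assms by (simp add: radius_fun_def power_0_left)
qed

text \<open>Every summand is nondecreasing; strictness comes from the bare \<open>r\<close> inside
  the \<open>p\<close>-th power.\<close>

lemma radius_fun_strict_mono:
  assumes M: "M > 0" and p: "p \<ge> 1" and N: "N \<ge> 2" and xy: "0 \<le> x" "x < y" "y < 1"
  shows "radius_fun p t N M x < radius_fun p t N M y"
proof -
  have L: "0 \<le> x + (1 - x) * ln (1 - x)" "x + (1 - x) * ln (1 - x) \<le> y + (1 - y) * ln (1 - y)"
    using one_minus_ln_tail_mono[of x y 1] xy by simp_all
  have 1: "(x + 2 * M * (x + (1 - x) * ln (1 - x))) ^ p < (y + 2 * M * (y + (1 - y) * ln (1 - y))) ^ p"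
  proof (rule power_strict_mono)
    show "x + 2 * M * (x + (1 - x) * ln (1 - x)) < y + 2 * M * (y + (1 - y) * ln (1 - y))"
      using L M xy by (intro add_less_le_mono mult_left_mono) auto
  qed (use L M xy p in auto)
  have 2: "2 * M * (x + (1 - x) * ln (1 - x) - (\<Sum>n=2..N-1. x ^ n / (real n * (real n - 1))))
       \<le> 2 * M * (y + (1 - y) * ln (1 - y) - (\<Sum>n=2..N-1. y ^ n / (real n * (real n - 1))))"
    using one_minus_ln_tail_mono(2)[of x y N] xy N M by (intro mult_left_mono) auto
  have 3: "sgn (real t) * (\<Sum>n=2..t. (2 * M / (real n * (real n - 1)))\<^sup>2) * (x ^ N / (1 - x))
      \<le> sgn (real t) * (\<Sum>n=2..t. (2 * M / (real n * (real n - 1)))\<^sup>2) * (y ^ N / (1 - y))"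
    using xy by (intro mult_left_mono frac_le power_mono mult_nonneg_nonneg sum_nonneg) auto
  have sq: "0 \<le> x\<^sup>2" "x\<^sup>2 \<le> y\<^sup>2" "y\<^sup>2 < 1"
    using xy by (auto intro: power_mono simp: abs_square_less_1)
  have 4: "4 * M\<^sup>2 / (1 - x) *
       (x\<^sup>2 + (1 - x\<^sup>2) * ln (1 - x\<^sup>2) - (\<Sum>n=2..t. x ^ (2 * n) / (real n * (real n - 1))))
      \<le> 4 * M\<^sup>2 / (1 - y) *
       (y\<^sup>2 + (1 - y\<^sup>2) * ln (1 - y\<^sup>2) - (\<Sum>n=2..t. y ^ (2 * n) / (real n * (real n - 1))))"
    using one_minus_ln_tail_mono[OF sq, of "t + 1"] xy
    by (intro mult_mono frac_le) (auto simp: power_mult)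
  show ?thesis unfolding radius_fun_def using 1 2 3 4 by linarith
qed

subsection \<open>The extremal map\<close>

text \<open>The normalized analytic solution h of M + z h'' = M(1 + z)/(1 - z), the half-plane map
  giving equality in the bounds of Harnack and Caratheodory.\<close>

definition extremal_map :: "real \<Rightarrow> complex \<Rightarrow> complex" where
  "extremal_map M z = z + 2 * of_real M * (z + (1 - z) * Ln (1 - z))"

definition extremal_coeff :: "real \<Rightarrow> nat \<Rightarrow> complex" where
  "extremal_coeff M n = of_real (2 * M / (real n * (real n - 1)))"

lemma extremal_expansion: "harmonic_expansion (extremal_map M) (extremal_coeff M) (\<lambda>_. 0)"
proof -
  have "(\<lambda>n. extremal_coeff M (n + 2) * z ^ (n + 2)) sums (2 * of_real M * (z + (1 - z) * Ln (1 - z)))"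
    if z: "cmod z < 1" for z
  proof -
    have "(\<lambda>n. 2 * of_real M * (z ^ n / (of_nat n * (of_nat n - 1)))) sums
       (2 * of_real M * (z + (1 - z) * Ln (1 - z)))"
      by (intro sums_mult one_minus_Ln_sums z)
    also have "(\<lambda>n. 2 * of_real M * (z ^ n / (of_nat n * (of_nat n - 1)))) = (\<lambda>n. extremal_coeff M n * z ^ n)"
      by (simp add: extremal_coeff_def)
    finally show ?thesis
      using sums_iff_shift[where f = "\<lambda>n. extremal_coeff M n * z ^ n" and n = 2
        and s = "2 * of_real M * (z + (1 - z) * Ln (1 - z))"]
      by (simp add: numeral_2_eq_2 extremal_coeff_def)
  qed
  then show ?thesis
    unfolding harmonic_expansion_def extremal_map_def by (auto simp: sums_iff)
qed

lemma extremal_in_P0H: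
  assumes M: "M > 0"
  shows "extremal_map M \<in> P0H M"
proof -
  have slit: "1 - z \<notin> \<real>\<^sub>\<le>\<^sub>0" "1 - z \<noteq> 0" if "z \<in> ball 0 1" for z :: complex
  proof -
    have "Re z < 1" using that complex_Re_le_cmod[of z] by simp
    then show "1 - z \<notin> \<real>\<^sub>\<le>\<^sub>0" by (auto simp: complex_nonpos_Reals_iff)
    show "1 - z \<noteq> 0" using that by auto
  qed
  have d1: "(extremal_map M has_field_derivative 1 - 2 * of_real M * Ln (1 - z)) (at z)"
    if z: "z \<in> ball 0 1" for z
    unfolding extremal_map_def
    by (rule derivative_eq_intros refl slit z)+ (use slit(2)[OF z] in \<open>simp add: field_simps\<close>)
  have d2: "(deriv (extremal_map M) has_field_derivative 2 * of_real M / (1 - z)) (at z)"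
    if z: "z \<in> ball 0 1" for z
  proof (rule has_field_derivative_transform_within_open[OF _ open_ball z])
    show "((\<lambda>z. 1 - 2 * of_real M * Ln (1 - z)) has_field_derivative 2 * of_real M / (1 - z)) (at z)"
      by (rule derivative_eq_intros refl slit z)+ (use slit(2)[OF z] in \<open>simp add: field_simps\<close>)
  qed (simp add: DERIV_imp_deriv[OF d1])
  have "extremal_map M holomorphic_on ball 0 1"
    unfolding holomorphic_on_open[OF open_ball] using d1 by blast
  then have "H0_decomp (extremal_map M) (extremal_map M) (\<lambda>_. 0)"
    using DERIV_imp_deriv[OF d1, of 0] by (simp add: H0_decomp_def extremal_map_def)
  moreover have "Re (z * deriv (deriv (extremal_map M)) z) > - M" if z: "z \<in> ball 0 1" for z
  proof -
    \<comment> \<open>Rewritten in terms of \<open>1 - z\<close>, this says that 1/(1 - z) has real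
      part above 1/2; and z h'' = 2M/(1 - z) - 2M.\<close>
    have "(cmod z)\<^sup>2 < 1" using z by (simp add: abs_square_less_1)
    then have "(cmod (1 - z))\<^sup>2 < 2 * Re (1 - z)"
      unfolding cmod_power2 by (simp add: power2_eq_square algebra_simps)
    moreover have "0 < (cmod (1 - z))\<^sup>2" using slit(2)[OF z] by simp
    ultimately have "1 / 2 < Re (1 / (1 - z))"
      by (simp add: Re_divide cmod_power2 field_simps)
    then have "2 * M * (1 / 2) < 2 * M * Re (1 / (1 - z))"
      using M by (intro mult_strict_left_mono) auto
    moreover have "z * deriv (deriv (extremal_map M)) z = of_real (2 * M) * (1 / (1 - z)) - of_real (2 * M)"
      unfolding DERIV_imp_deriv[OF d2[OF z]] using slit(2)[OF z] by (simp add: field_simps)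
    moreover have "Re (of_real c * w - of_real c) = c * Re w - c" for c w by simp
    ultimately show ?thesis by (simp only:)
  qed
  ultimately show ?thesis unfolding P0H_def
    by (intro CollectI exI[of _ "extremal_map M"] exI[of _ "\<lambda>_. 0"])
      (simp del: times_complex.sel)
qed

lemma extremal_of_real:
  assumes "x < 1"
  shows "extremal_map M (of_real x) = of_real (x + 2 * M * (x + (1 - x) * ln (1 - x)))"
proof -
  have "Ln (1 - of_real x) = of_real (ln (1 - x))"
    using Ln_of_real[of "1 - x"] assms by simp
  then show ?thesis by (simp add: extremal_map_def)
qed

text \<open>Along the negative radius the map is real and tends to -(1 + 2M(1 - ln 4)); the
  hypothesis makes the modulus of this limit the stated bound.\<close>

lemma bdry_dist_extremal_le:
  assumes "1 + 2 * M * (1 - ln 4) \<ge> 0"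
  shows "bdry_dist (extremal_map M) \<le> ereal (1 + 2 * M * (1 - ln 4))"
proof (rule dense_ge)
  fix y assume "ereal (1 + 2 * M * (1 - ln 4)) < y"
  show "bdry_dist (extremal_map M) \<le> y"
  proof (rule ccontr)
    assume "\<not> ?thesis"
    then have "y < Liminf (filtercomap cmod (at_left 1)) (\<lambda>z. ereal (cmod (extremal_map M z - extremal_map M 0)))"
      by (simp add: bdry_dist_def)
    then have "\<forall>\<^sub>F z in filtercomap cmod (at_left 1). y < ereal (cmod (extremal_map M z - extremal_map M 0))"
      by (rule less_LiminfD)
    \<comment> \<open>The filter sees only moduli, so the estimate may be used at the point
      \<open>- r\<close> of each circle.\<close>
    then obtain Q where Q: "eventually Q (at_left 1)" "\<And>z. Q (cmod z) \<Longrightarrow> y < ereal (cmod (extremal_map M z))"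
      unfolding eventually_filtercomap by (auto simp: extremal_map_def)
    define \<psi> where "\<psi> = (\<lambda>r::real. \<bar>- r + 2 * M * (- r + (1 + r) * ln (1 + r))\<bar>)"
    have "\<psi> 1 = 1 + 2 * M * (1 - ln 4)"
      using ln_realpow[of 2 2] assms by (simp add: \<psi>_def algebra_simps)
    moreover have "(\<psi> \<longlongrightarrow> \<psi> 1) (at_left 1)"
      unfolding \<psi>_def by (intro tendsto_intros) auto
    ultimately have lim: "((\<lambda>r. ereal (\<psi> r)) \<longlongrightarrow> ereal (1 + 2 * M * (1 - ln 4))) (at_left 1)" by simp
    have "\<forall>\<^sub>F r in at_left 1. y \<le> ereal (\<psi> r)"
      using Q(1) eventually_at_left_real[of 0 "1::real", OF zero_less_one]
    proof eventually_elim
      case (elim r)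
      have "cmod (extremal_map M (of_real (- r))) = \<psi> r"
        using elim by (subst extremal_of_real) (auto simp only: norm_of_real \<psi>_def, auto)
      then show ?case
        using Q(2)[of "of_real (- r)"] elim by (auto intro: less_imp_le)
    qed
    from tendsto_lowerbound[OF lim this] show False
      using \<open>ereal (1 + 2 * M * (1 - ln 4)) < y\<close> by simp
  qed
qed

text \<open>At a point of the positive radius every term attains its bound. The two summability
  claims supply the comparison series for the whole class.\<close>

lemma bohr_sum_extremal:
  assumes r: "0 \<le> r" "r < 1" and M: "M > 0" and N: "N \<ge> 2"
  shows "bohr_sum p t N (extremal_map M) (extremal_coeff M) (\<lambda>_. 0) (of_real r)
    = radius_fun p t N M r + (1 + 2 * M * (1 - ln 4))"
    and "summable (\<lambda>n. 2 * M / (real (n + N) * (real (n + N) - 1)) * r ^ (n + N))"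
    and "summable (\<lambda>n. real (n + (t + 1)) * (real (n + (t + 1)) - 1)
           * (2 * M / (real (n + (t + 1)) * (real (n + (t + 1)) - 1)))\<^sup>2 * r ^ (2 * (n + (t + 1))))"
proof -
  have "real n * (real n - 1) \<ge> 0" for n by (cases n) auto
  then have c: "cmod (extremal_coeff M n) = 2 * M / (real n * (real n - 1))" for n
    using M unfolding extremal_coeff_def norm_of_real by (intro abs_of_nonneg divide_nonneg_nonneg) auto
  have "0 \<le> r + (1 - r) * ln (1 - r)"
    using one_minus_ln_tail_mono(1)[of r r 1] r by simp
  then have f: "cmod (extremal_map M (of_real r)) = r + 2 * M * (r + (1 - r) * ln (1 - r))"
    unfolding extremal_of_real[OF r(2)] norm_of_real using r M by (intro abs_of_nonneg) auto
  have "(\<lambda>n. 2 * M * (r ^ (n + N) / (real (n + N) * (real (n + N) - 1)))) sums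
      (2 * M * (r + (1 - r) * ln (1 - r) - (\<Sum>n=2..N-1. r ^ n / (real n * (real n - 1)))))"
    by (intro sums_mult one_minus_ln_tail_sums) (use r N in auto)
  then have s1: "(\<lambda>n. 2 * M / (real (n + N) * (real (n + N) - 1)) * r ^ (n + N)) sums
      (2 * M * (r + (1 - r) * ln (1 - r) - (\<Sum>n=2..N-1. r ^ n / (real n * (real n - 1)))))"
    by (simp only: times_divide_eq_right times_divide_eq_left)
  have "r\<^sup>2 < 1" using r by (simp add: abs_square_less_1)
  then have "(\<lambda>n. 4 * M\<^sup>2 * ((r\<^sup>2) ^ (n + (t + 1)) / (real (n + (t + 1)) * (real (n + (t + 1)) - 1)))) sums
      (4 * M\<^sup>2 * (r\<^sup>2 + (1 - r\<^sup>2) * ln (1 - r\<^sup>2) - (\<Sum>n=2..(t+1)-1. (r\<^sup>2) ^ n / (real n * (real n - 1)))))"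
    by (intro sums_mult one_minus_ln_tail_sums) auto
  \<comment> \<open>Both sides are 0 for \<open>d = 0\<close>, which covers the index n = 1
    occurring when \<open>t = 0\<close>.\<close>
  moreover have "4 * M\<^sup>2 * (x / d) = d * (2 * M / d)\<^sup>2 * x" for x d :: real
    by (simp add: power2_eq_square)
  ultimately have s2: "(\<lambda>n. real (n + (t + 1)) * (real (n + (t + 1)) - 1)
           * (2 * M / (real (n + (t + 1)) * (real (n + (t + 1)) - 1)))\<^sup>2 * r ^ (2 * (n + (t + 1)))) sums
      (4 * M\<^sup>2 * (r\<^sup>2 + (1 - r\<^sup>2) * ln (1 - r\<^sup>2) - (\<Sum>n=2..t. r ^ (2 * n) / (real n * (real n - 1)))))"
    by (simp only: power_mult add_diff_cancel_right')
  show "summable (\<lambda>n. 2 * M / (real (n + N) * (real (n + N) - 1)) * r ^ (n + N))"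
    "summable (\<lambda>n. real (n + (t + 1)) * (real (n + (t + 1)) - 1)
           * (2 * M / (real (n + (t + 1)) * (real (n + (t + 1)) - 1)))\<^sup>2 * r ^ (2 * (n + (t + 1))))"
    by (rule sums_summable[OF s1] sums_summable[OF s2])+
  have "cmod (of_real r) = r" using r by simp
  then show "bohr_sum p t N (extremal_map M) (extremal_coeff M) (\<lambda>_. 0) (of_real r)
    = radius_fun p t N M r + (1 + 2 * M * (1 - ln 4))"
    unfolding bohr_sum_def Let_def radius_fun_def
    by (simp only: c f norm_zero add_0_right sums_unique[OF s1, symmetric] sums_unique[OF s2, symmetric])
       (simp add: field_simps)
qed

subsection \<open>The Bohr inequality\<close>

text \<open>Triangle inequality with the coefficient bound; absolute convergence follows by
  comparison with the logarithmic tail from n = 2.\<close>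

lemma P0H_upper_growth:
  assumes f: "f \<in> P0H M" and e: "harmonic_expansion f a b" and z: "cmod z < 1"
  shows "cmod (f z) \<le> cmod z + 2 * M * (cmod z + (1 - cmod z) * ln (1 - cmod z))"
proof -
  have s: "summable (\<lambda>n. a (n + 2) * z ^ (n + 2))" "summable (\<lambda>n. b (n + 2) * z ^ (n + 2))"
    and fz: "f z = z + (\<Sum>n. a (n + 2) * z ^ (n + 2)) + cnj (\<Sum>n. b (n + 2) * z ^ (n + 2))"
    using e z by (auto simp: harmonic_expansion_def)
  define c where "c = (\<lambda>n. cmod (a (n + 2)) * cmod z ^ (n + 2) + cmod (b (n + 2)) * cmod z ^ (n + 2))"
  have T: "(\<lambda>n. 2 * M * (cmod z ^ (n + 2) / (real (n + 2) * (real (n + 2) - 1)))) sums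
      (2 * M * (cmod z + (1 - cmod z) * ln (1 - cmod z)))"
    using sums_mult[OF one_minus_ln_tail_sums[of "cmod z" 2], of "2 * M"] z by simp
  have le: "c n \<le> 2 * M * (cmod z ^ (n + 2) / (real (n + 2) * (real (n + 2) - 1)))" for n
    using mult_right_mono[OF P0H_coeff_bound[OF f e, of "n + 2"], of "cmod z ^ (n + 2)"]
    by (simp add: c_def distrib_right)
  have sc: "summable c"
    by (rule summable_comparison_test'[OF sums_summable[OF T]]) (use le in \<open>simp add: c_def\<close>)
  have sa: "summable (\<lambda>n. cmod (a (n + 2) * z ^ (n + 2)))" "summable (\<lambda>n. cmod (b (n + 2) * z ^ (n + 2)))"
    by (rule summable_comparison_test'[OF sc]; simp add: c_def norm_mult norm_power)+
  have "cmod (f z) \<le> cmod z + cmod (\<Sum>n. a (n + 2) * z ^ (n + 2)) + cmod (\<Sum>n. b (n + 2) * z ^ (n + 2))"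
    unfolding fz by (metis (no_types, lifting) add_mono complex_mod_cnj norm_triangle_ineq norm_triangle_le order_refl order_trans add_right_mono)
  also have "\<dots> \<le> cmod z + (\<Sum>n. cmod (a (n + 2) * z ^ (n + 2))) + (\<Sum>n. cmod (b (n + 2) * z ^ (n + 2)))"
    by (intro add_mono order_refl summable_norm sa)
  also have "\<dots> = cmod z + (\<Sum>n. c n)"
    using suminf_add[OF sa] by (simp add: c_def norm_mult norm_power)
  also have "(\<Sum>n. c n) \<le> 2 * M * (cmod z + (1 - cmod z) * ln (1 - cmod z))"
    using sums_le[OF le summable_sums[OF sc] T] .
  finally show ?thesis by simp
qed

text \<open>The sum is monotone in \<open>cmod (f z)\<close> and in every |a n| + |b n|, so passing
  to the extremal map at the real point \<open>cmod z\<close> can only increase it.\<close>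

lemma bohr_sum_le:
  assumes f: "f \<in> P0H M" and e: "harmonic_expansion f a b" and z: "cmod z < 1"
    and M: "M > 0" and N: "N \<ge> 2"
  shows "bohr_sum p t N f a b z \<le> radius_fun p t N M (cmod z) + (1 + 2 * M * (1 - ln 4))"
proof -
  define r where "r = cmod z"
  define c where "c = (\<lambda>n. cmod (a n) + cmod (b n))"
  define d where "d = (\<lambda>n. 2 * M / (real n * (real n - 1)))"
  have r: "0 \<le> r" "r < 1" using z by (auto simp: r_def)
  have nn: "real n * (real n - 1) \<ge> 0" for n by (cases n) auto
  have c0: "0 \<le> c n" for n by (simp add: c_def)
  have cd: "c n \<le> d n" if "n \<ge> 2" for n using P0H_coeff_bound[OF f e that] by (simp add: c_def d_def)
  have d_eq: "cmod (extremal_coeff M n) + cmod 0 = d n" for n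
    using nn[of n] M unfolding extremal_coeff_def norm_of_real d_def norm_zero add_0_right
    by (intro abs_of_nonneg divide_nonneg_nonneg) auto
  have "0 \<le> r + (1 - r) * ln (1 - r)"
    using one_minus_ln_tail_mono(1)[of r r 1] r by simp
  then have "cmod (extremal_map M (of_real r)) = r + 2 * M * (r + (1 - r) * ln (1 - r))"
    unfolding extremal_of_real[OF r(2)] norm_of_real using r M by (intro abs_of_nonneg) auto
  then have F: "cmod (f z) \<le> cmod (extremal_map M (of_real r))"
    using P0H_upper_growth[OF f e z] by (simp add: r_def)
  have c2: "real n * (real n - 1) * (c n)\<^sup>2 \<le> real n * (real n - 1) * (d n)\<^sup>2" for n
  \<comment> \<open>The coefficient bound starts at 2; below that the factor n(n - 1) is
    zero.\<close>
  proof (cases "n \<ge> 2")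
    case True
    then show ?thesis by (intro mult_left_mono power_mono cd c0 nn)
  next
    case False
    then have "n = 0 \<or> n = 1" by auto
    then show ?thesis by auto
  qed
  have le1: "c (n + N) * r ^ (n + N) \<le> d (n + N) * r ^ (n + N)" for n
    using N r by (intro mult_right_mono cd) auto
  have le2: "real (n + (t + 1)) * (real (n + (t + 1)) - 1) * (c (n + (t + 1)))\<^sup>2 * r ^ (2 * (n + (t + 1)))
    \<le> real (n + (t + 1)) * (real (n + (t + 1)) - 1) * (d (n + (t + 1)))\<^sup>2 * r ^ (2 * (n + (t + 1)))" for n
    using r by (intro mult_right_mono c2) auto
  have sd: "summable (\<lambda>n. d (n + N) * r ^ (n + N))"
    "summable (\<lambda>n. real (n + (t + 1)) * (real (n + (t + 1)) - 1) * (d (n + (t + 1)))\<^sup>2 * r ^ (2 * (n + (t + 1))))"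
    unfolding d_def using bohr_sum_extremal(2,3)[OF r M N] by blast+
  have sc: "summable (\<lambda>n. c (n + N) * r ^ (n + N))"
    by (rule summable_comparison_test'[OF sd(1)]) (use le1 c0 r in \<open>simp add: abs_mult\<close>)
  have sc2: "summable (\<lambda>n. real (n + (t + 1)) * (real (n + (t + 1)) - 1) * (c (n + (t + 1)))\<^sup>2 * r ^ (2 * (n + (t + 1))))"
  proof (rule summable_comparison_test'[OF sd(2)])
    fix n :: nat
    have "0 \<le> real (n + (t + 1)) * (real (n + (t + 1)) - 1) * (c (n + (t + 1)))\<^sup>2 * r ^ (2 * (n + (t + 1)))"
      using nn r by (intro mult_nonneg_nonneg) auto
    then show "norm (real (n + (t + 1)) * (real (n + (t + 1)) - 1) * (c (n + (t + 1)))\<^sup>2 * r ^ (2 * (n + (t + 1))))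
      \<le> real (n + (t + 1)) * (real (n + (t + 1)) - 1) * (d (n + (t + 1)))\<^sup>2 * r ^ (2 * (n + (t + 1)))"
      using le2[of n] by (simp only: real_norm_def abs_of_nonneg)
  qed
  have "bohr_sum p t N f a b z = cmod (f z) ^ p + (\<Sum>n. c (n + N) * r ^ (n + N))
      + sgn (real t) * (\<Sum>n=2..t. (c n)\<^sup>2) * (r ^ N / (1 - r))
      + 1 / (1 - r) * (\<Sum>n. real (n + (t + 1)) * (real (n + (t + 1)) - 1) * (c (n + (t + 1)))\<^sup>2 * r ^ (2 * (n + (t + 1))))"
    by (simp add: bohr_sum_def Let_def r_def c_def)
  also have "\<dots> \<le> cmod (extremal_map M (of_real r)) ^ p + (\<Sum>n. d (n + N) * r ^ (n + N))
      + sgn (real t) * (\<Sum>n=2..t. (d n)\<^sup>2) * (r ^ N / (1 - r))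
      + 1 / (1 - r) * (\<Sum>n. real (n + (t + 1)) * (real (n + (t + 1)) - 1) * (d (n + (t + 1)))\<^sup>2 * r ^ (2 * (n + (t + 1))))"
    using r by (intro add_mono power_mono F mult_left_mono mult_right_mono sum_mono suminf_le sc sc2 sd le1 le2 cd c0) auto
  also have "\<dots> = bohr_sum p t N (extremal_map M) (extremal_coeff M) (\<lambda>_. 0) (of_real r)"
    unfolding bohr_sum_def Let_def d_eq norm_of_real abs_of_nonneg[OF r(1)] by simp
  finally show ?thesis using bohr_sum_extremal(1)[OF r M N] by (simp add: r_def)
qed

text \<open>Near 1 the \<open>p\<close>-th power is at least 1 and cancels the constant -1; the
  other summands are nonnegative and -2M(1 - ln 4) is positive.\<close>

lemma radius_fun_pos:
  assumes M: "M > 0" and N: "N \<ge> 2"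
  shows "\<exists>r. 0 < r \<and> r < 1 \<and> radius_fun p t N M r > 0"
proof -
  have "((\<lambda>r::real. r + M * r\<^sup>2) \<longlongrightarrow> 1 + M * 1\<^sup>2) (at_left 1)"
    by (intro tendsto_intros)
  from order_tendstoD(1)[OF this, of 1] M
  have "\<forall>\<^sub>F r in at_left 1. 1 < r + M * r\<^sup>2" by simp
  with eventually_at_left_real[of 0 "1::real", OF zero_less_one]
  have "\<forall>\<^sub>F r in at_left 1. 0 < r \<and> r < 1 \<and> 1 < r + M * r\<^sup>2"
    by eventually_elim auto
  then obtain r where r: "0 < r" "r < 1" "1 < r + M * r\<^sup>2"
    using eventually_happens trivial_limit_at_left_real by blast
  \<comment> \<open>Nonnegativity of the tail from n = 3 leaves the term n = 2 as a lower
    bound.\<close>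
  have "r\<^sup>2 / 2 \<le> r + (1 - r) * ln (1 - r)"
    using one_minus_ln_tail_mono(1)[of r r 3] r by simp
  then have "2 * M * (r\<^sup>2 / 2) \<le> 2 * M * (r + (1 - r) * ln (1 - r))"
    using M by (intro mult_left_mono) auto
  then have "1 \<le> (r + 2 * M * (r + (1 - r) * ln (1 - r))) ^ p"
    using r by (intro one_le_power) simp
  moreover have "0 \<le> 2 * M * (r + (1 - r) * ln (1 - r) - (\<Sum>n=2..N-1. r ^ n / (real n * (real n - 1))))"
    using one_minus_ln_tail_mono(1)[of r r N] r N M by (intro mult_nonneg_nonneg) auto
  moreover have "0 \<le> sgn (real t) * (\<Sum>n=2..t. (2 * M / (real n * (real n - 1)))\<^sup>2) * (r ^ N / (1 - r))"
    using r by (intro mult_nonneg_nonneg sum_nonneg) auto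
  moreover have "0 \<le> 4 * M\<^sup>2 / (1 - r) *
       (r\<^sup>2 + (1 - r\<^sup>2) * ln (1 - r\<^sup>2) - (\<Sum>n=2..t. r ^ (2 * n) / (real n * (real n - 1))))"
    using one_minus_ln_tail_mono(1)[of "r\<^sup>2" "r\<^sup>2" "t + 1"] r
    by (intro mult_nonneg_nonneg) (auto simp: power_mult abs_square_less_1)
  moreover have "2 * M * (1 - ln 4) < 0"
  proof -
    have "(1::real) < ln 4" using ln_realpow[of 2 2] ln2_ge_two_thirds by simp
    then show ?thesis using M by (simp add: mult_pos_neg)
  qed
  ultimately have "radius_fun p t N M r > 0" unfolding radius_fun_def by linarith
  with r show ?thesis by blast
qed

lemma radius_fun_continuous:
  assumes "s < 1"
  shows "continuous_on {0..s} (radius_fun p t N M)"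
proof -
  have "x\<^sup>2 < 1" if "x \<in> {0..s}" for x using that assms by (simp add: abs_square_less_1)
  then show ?thesis
    unfolding radius_fun_def using assms by (intro continuous_intros) fastforce+
qed

theorem theorem4p1:
  fixes M :: real and p N t :: nat
  assumes "M > 0" and "p \<ge> 1" and "N \<ge> 2" and "t = (N - 1) div 2"
  shows "(2 * M * (ln 4 - 1) < 1 \<longrightarrow> (\<exists>R. least_root01 (radius_fun p t N M) R)) \<and>
         (\<forall>R. least_root01 (radius_fun p t N M) R \<longrightarrow>
            bohr_holds_upto p t N M R \<and>
            (\<forall>\<rho>. R < \<rho> \<and> \<rho> < 1 \<longrightarrow> \<not> bohr_holds_upto p t N M \<rho>))"
proof (intro conjI impI allI)
  assume "2 * M * (ln 4 - 1) < 1"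
  \<comment> \<open>The assumption says exactly that the value at 0 is negative. The intermediate
    value theorem gives a root, and strict monotonicity excludes smaller ones.\<close>
  then have neg: "radius_fun p t N M 0 < 0"
    by (simp add: radius_fun_0[OF assms(2,3)] algebra_simps)
  obtain s where s: "0 < s" "s < 1" "radius_fun p t N M s > 0"
    using radius_fun_pos[OF assms(1,3)] by blast
  obtain R where R: "0 \<le> R" "R \<le> s" "radius_fun p t N M R = 0"
    using IVT'[of "radius_fun p t N M" 0 0 s] neg s radius_fun_continuous[of s] by auto
  have "R \<noteq> 0" using neg R by auto
  moreover have "radius_fun p t N M r \<noteq> 0" if "0 < r" "r < R" for r
    using radius_fun_strict_mono[OF assms(1-3), of r R t] that R s by auto
  ultimately show "\<exists>R. least_root01 (radius_fun p t N M) R"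
    using R s by (intro exI[of _ R]) (auto simp: least_root01_def)
next
  fix R assume "least_root01 (radius_fun p t N M) R"
  then have R: "0 < R" "R < 1" "radius_fun p t N M R = 0" by (auto simp: least_root01_def)
  show "bohr_holds_upto p t N M R"
    unfolding bohr_holds_upto_def
  proof (intro allI impI)
    fix f a b z
    assume f: "f \<in> P0H M" and e: "harmonic_expansion f a b" and z: "cmod z \<le> R"
    have "radius_fun p t N M (cmod z) \<le> 0"
      using radius_fun_strict_mono[OF assms(1-3), of "cmod z" R t] z R by (cases "cmod z = R") auto
    then have "ereal (bohr_sum p t N f a b z) \<le> ereal (1 + 2 * M * (1 - ln 4))"
      using bohr_sum_le[OF f e _ assms(1,3), of z p t] z R by simp
    then show "ereal (bohr_sum p t N f a b z) \<le> bdry_dist f"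
      using bdry_dist_ge[OF f] by (rule order_trans)
  qed
  fix \<rho> assume \<rho>: "R < \<rho> \<and> \<rho> < 1"
  show "\<not> bohr_holds_upto p t N M \<rho>"
  proof
    assume "bohr_holds_upto p t N M \<rho>"
    \<comment> \<open>Sharpness: the extremal map is tested at the positive real point
      \<open>\<rho>\<close>, where its Bohr sum is known exactly.\<close>
    then have "ereal (bohr_sum p t N (extremal_map M) (extremal_coeff M) (\<lambda>_. 0) (of_real \<rho>))
        \<le> bdry_dist (extremal_map M)"
      using extremal_in_P0H[OF assms(1)] extremal_expansion \<rho> R by (auto simp: bohr_holds_upto_def)
    also have "\<dots> \<le> ereal (1 + 2 * M * (1 - ln 4))"
      \<comment> \<open>A positive root makes the value at 0 negative, which yields the sign
        condition 1 + 2M(1 - ln 4) > 0 behind the distance bound.\<close>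
      using radius_fun_strict_mono[OF assms(1-3), of 0 R t] R radius_fun_0[OF assms(2,3), of t M]
      by (intro bdry_dist_extremal_le) simp
    finally have "radius_fun p t N M \<rho> \<le> 0"
      using bohr_sum_extremal(1)[OF _ _ assms(1,3), of \<rho> p t] \<rho> R by simp
    then show False
      using radius_fun_strict_mono[OF assms(1-3), of R \<rho> t] \<rho> R by simp
  qed
qed

end
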